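(* Let $\Gamma=(V,H)$ be an oriented hypergraph on $n$ vertices with no vertex of degree zero and with only inputs, i.e. $h_{out}=\emptyset$ for every $h\in H$. Let $\lambda_1\le\dots\le\lambda_n$ be the eigenvalues of its normalized Laplacian $L$. If $f$ is an eigenfunction of $L$ for the eigenvalue $\lambda_k$ and $\lambda_k$ has multiplicity $r$, then the total number of positive and negative nodal domains of $f$ is at most $n-k+r$.
   Context: An oriented hypergraph is a pair $\Gamma=(V,H)$ where $V$ is a finite vertex set and each hyperedge $h\in H$ is a pair $(h_{in},h_{out})$ of disjoint subsets of $V$; $h$ is identified with $h_{in}\cup h_{out}$. $\deg(i)$ is the number of hyperedges containing $i$. The normalized Laplacian acts on $f:V\to\mathbb{R}$ by $$Lf(i)=\frac{1}{\deg(i)}\Big[\sum_{h:\,i\in h_{in}}\Big(\sum_{i'\in h_{in}}f(i')-\sum_{j'\in h_{out}}f(j')\Big)-\sum_{h:\,i\in h_{out}}\Big(\sum_{i'\in h_{in}}f(i')-\sum_{j'\in h_{out}}f(j')\Big)\Big];$$ its eigenvalues are real and listed with multiplicity as $\lambda_1\le\dots\le\lambda_n$. Connected components of a hypergraph are the maximal vertex sets in which any two vertices are joined by a sequence of vertices with consecutive ones lying in a common hyperedge. Let $\mathrm{supp}_\pm(f)=\{i\in V:\pm f(i)>0\}$. A positive (resp. negative) nodal domain of $f$ is (the vertex set of) a connected component of the hypergraph with vertex set $\mathrm{supp}_+(f)$ (resp. $\mathrm{supp}_-(f)$) and hyperedge set $\{h\cap\mathrm{supp}_+(f):h\in H\}$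 (resp. $\{h\cap\mathrm{supp}_-(f):h\in H\}$). *)

theory Defs
  imports "HOL-Analysis.Analysis" "HOL-Library.Multiset"
begin

text \<open>
  The vertex set is the finite type \<open>'v\<close>, and a function \<open>f : V \<rightarrow> \<real>\<close> is a vector
  \<open>f :: real ^ 'v\<close> with \<open>f $ i\<close> the value at \<open>i\<close>. A hyperedge is the pair of its set of
  inputs and its set of outputs.
\<close>

type_synonym 'v hyperedge = "'v set \<times> 'v set"

definition oriented_hypergraph :: "'v hyperedge set \<Rightarrow> bool" where
  "oriented_hypergraph H \<longleftrightarrow> (\<forall>h\<in>H. fst h \<inter> snd h = {})"

definition verts :: "'v hyperedge \<Rightarrow> 'v set" where
  "verts h = fst h \<union> snd h"

definition hdegree :: "'v hyperedge set \<Rightarrow> 'v \<Rightarrow> nat" where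
  "hdegree H i = card {h \<in> H. i \<in> verts h}"

definition laplacian :: "'v::finite hyperedge set \<Rightarrow> real ^ 'v \<Rightarrow> real ^ 'v" where
  "laplacian H f = (\<chi> i. 1 / real (hdegree H i) *
     ((\<Sum>h | h \<in> H \<and> i \<in> fst h. (\<Sum>i'\<in>fst h. f $ i') - (\<Sum>j'\<in>snd h. f $ j'))
    - (\<Sum>h | h \<in> H \<and> i \<in> snd h. (\<Sum>i'\<in>fst h. f $ i') - (\<Sum>j'\<in>snd h. f $ j'))))"

definition eigenfunction :: "(real ^ 'v \<Rightarrow> real ^ 'v) \<Rightarrow> real \<Rightarrow> real ^ 'v::finite \<Rightarrow> bool" where
  "eigenfunction T \<mu> f \<longleftrightarrow> f \<noteq> 0 \<and> T f = \<mu> *\<^sub>R f"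

text \<open>
  The normalized Laplacian is self-adjoint for the degree-weighted inner product, so the
  dimension of an eigenspace is also the algebraic multiplicity of the eigenvalue.
\<close>

definition eigenvalue_mult :: "(real ^ 'v \<Rightarrow> real ^ 'v::finite) \<Rightarrow> real \<Rightarrow> nat" where
  "eigenvalue_mult T \<mu> = dim {f. T f = \<mu> *\<^sub>R f}"

definition eigenvalue_list :: "(real ^ 'v \<Rightarrow> real ^ 'v::finite) \<Rightarrow> real list" where
  "eigenvalue_list T = sorted_list_of_multiset
     (\<Sum>\<mu> | (\<exists>f. eigenfunction T \<mu> f). replicate_mset (eigenvalue_mult T \<mu>) \<mu>)"

text \<open>The \<open>k\<close>-th smallest eigenvalue, counted with multiplicity and indexed from 1.\<close>

definition kth_eigenvalue :: "(real ^ 'v \<Rightarrow> real ^ 'v::finite) \<Rightarrow> nat \<Rightarrow> real" where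
  "kth_eigenvalue T k = eigenvalue_list T ! (k - 1)"

definition joined :: "'v set set \<Rightarrow> 'v \<Rightarrow> 'v \<Rightarrow> bool" where
  "joined E = (\<lambda>i j. \<exists>e\<in>E. i \<in> e \<and> j \<in> e)\<^sup>*\<^sup>*"

text \<open>Nonemptiness is required so that the hypergraph without vertices has no component.\<close>

definition connected_components :: "'v set \<Rightarrow> 'v set set \<Rightarrow> 'v set set" where
  "connected_components W E =
     {C. C \<noteq> {} \<and> C \<subseteq> W \<and> (\<forall>i\<in>C. \<forall>j\<in>C. joined E i j) \<and>
         (\<forall>D. C \<subseteq> D \<and> D \<subseteq> W \<and> (\<forall>i\<in>D. \<forall>j\<in>D. joined E i j) \<longrightarrow> D = C)}"

definition supp_pos :: "real ^ 'v::finite \<Rightarrow> 'v set" where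
  "supp_pos f = {i. f $ i > 0}"

definition supp_neg :: "real ^ 'v::finite \<Rightarrow> 'v set" where
  "supp_neg f = {i. - (f $ i) > 0}"

definition pos_nodal_domains :: "'v::finite hyperedge set \<Rightarrow> real ^ 'v \<Rightarrow> 'v set set" where
  "pos_nodal_domains H f =
     connected_components (supp_pos f) {verts h \<inter> supp_pos f | h. h \<in> H}"

definition neg_nodal_domains :: "'v::finite hyperedge set \<Rightarrow> real ^ 'v \<Rightarrow> 'v set set" where
  "neg_nodal_domains H f =
     connected_components (supp_neg f) {verts h \<inter> supp_neg f | h. h \<in> H}"

end

theory Submission imports Defs begin

text \<open>
  With only inputs, the Laplacian is \<open>L = D\<^sup>-\<^sup>1 B\<close>, where \<open>D\<close> is the diagonal degree matrix and
  \<open>B i j \<ge> 0\<close> counts the hyperedges containing both \<open>i\<close> and \<open>j\<close>; it is self-adjoint for the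
  inner product weighted by \<open>D\<close>. If \<open>L f = \<lambda> f\<close> and \<open>g i = a i * f i\<close>, then
  \<open>\<langle>g, B g\<rangle> - \<lambda> \<langle>g, D g\<rangle> = - 1/2 * (\<Sum>i j. B i j * f i * f j * (a i - a j)\<^sup>2)\<close>.
  When \<open>a\<close> is constant on each nodal domain, the terms with \<open>f i * f j > 0\<close> vanish, so the Rayleigh
  quotient is at least \<open>\<lambda>\<close> on the span of the restrictions of \<open>f\<close> to its nodal domains. This span
  therefore meets the sum of the eigenspaces below \<open>\<lambda>\<close>, of dimension at least \<open>k - r\<close>, trivially.
\<close>

section \<open>Self-adjoint operators for a weighted inner product\<close>

text \<open>The inner product in question is \<open>\<langle>x, y\<rangle> = P x \<bullet> y\<close>.\<close>

locale weighted_selfadjoint =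
  fixes T P :: "'a::euclidean_space \<Rightarrow> 'a"
  assumes linear_T: "linear T" and linear_P: "linear P"
    and P_sym: "P x \<bullet> y = x \<bullet> P y"
    and P_pos: "x \<noteq> 0 \<Longrightarrow> P x \<bullet> x > 0"
    and T_selfadjoint: "P (T x) \<bullet> y = P x \<bullet> T y"
begin

section \<open>Eigenspaces and their sums\<close>

definition eigenspace :: "real \<Rightarrow> 'a set" where
  "eigenspace \<mu> = {x. T x = \<mu> *\<^sub>R x}"

definition eigensum :: "real set \<Rightarrow> 'a set" where
  "eigensum A = span (\<Union>\<mu>\<in>A. eigenspace \<mu>)"

definition eigenvalues :: "real set" where
  "eigenvalues = {\<mu>. \<exists>x. x \<noteq> 0 \<and> T x = \<mu> *\<^sub>R x}"

lemmas T_simps = linear_add[OF linear_T] linear_diff[OF linear_T] linear_cmul[OF linear_T]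
  linear_0[OF linear_T]
lemmas P_simps = linear_add[OF linear_P] linear_diff[OF linear_P] linear_cmul[OF linear_P]
  linear_0[OF linear_P]

lemma P_comm: "P x \<bullet> y = P y \<bullet> x"
  by (metis P_sym inner_commute)

lemma subspace_eigenspace: "subspace (eigenspace \<mu>)"
  unfolding eigenspace_def by (rule subspaceI) (auto simp: T_simps algebra_simps)

lemma orthogonal_eigenspaces:
  assumes "x \<in> eigenspace \<mu>" "y \<in> eigenspace \<nu>" "\<mu> \<noteq> \<nu>"
  shows "P x \<bullet> y = 0"
proof -
  have "\<mu> * (P x \<bullet> y) = \<nu> * (P x \<bullet> y)"
    using T_selfadjoint[of x y] assms by (simp add: eigenspace_def P_simps)
  then show ?thesis using assms(3) by simp
qed

lemma orthogonal_eigensum: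
  assumes "x \<in> eigensum A" "y \<in> eigenspace \<mu>" "\<mu> \<notin> A"
  shows "P x \<bullet> y = 0"
proof -
  have "subspace {x. P x \<bullet> y = 0}"
    by (rule subspaceI) (auto simp: P_simps inner_add_left)
  moreover have "(\<Union>\<nu>\<in>A. eigenspace \<nu>) \<subseteq> {x. P x \<bullet> y = 0}"
    using orthogonal_eigenspaces assms by blast
  ultimately have "eigensum A \<subseteq> {x. P x \<bullet> y = 0}"
    unfolding eigensum_def by (rule span_minimal[rotated])
  then show ?thesis using assms by auto
qed

lemma eigensum_empty: "eigensum {} = {0}"
  by (simp add: eigensum_def)

lemma subspace_eigensum: "subspace (eigensum A)"
  by (simp add: eigensum_def)

lemma eigensum_insert:
  "eigensum (insert \<mu> A) = {x + y | x y. x \<in> eigenspace \<mu> \<and> y \<in> eigensum A}"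
  unfolding eigensum_def UN_insert span_Un span_eq_iff[THEN iffD2, OF subspace_eigenspace]
  by (rule refl)

text \<open>Eigenspaces for distinct eigenvalues are orthogonal, so a new one meets the sum of the
  others only in 0 and the dimensions add up.\<close>

lemma dim_eigensum:
  assumes "finite A"
  shows "dim (eigensum A) = (\<Sum>\<mu>\<in>A. dim (eigenspace \<mu>))"
  using assms
proof (induction A)
  case empty
  then show ?case by (simp add: eigensum_empty)
next
  case (insert \<mu> A)
  have "x = 0" if "x \<in> eigenspace \<mu>" "x \<in> eigensum A" for x
    using orthogonal_eigensum[OF that(2,1) insert(2)] P_pos[of x] by fastforce
  then have "dim (eigenspace \<mu> \<inter> eigensum A) = 0"
    by (auto simp: dim_eq_0)
  then show ?case
    using dim_sums_Int[OF subspace_eigenspace subspace_eigensum, of \<mu> A] insert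
    by (simp add: eigensum_insert del: dim_eq_0)
qed

text \<open>Splitting off one eigenspace orthogonally removes the cross terms from both quadratic
  forms. Strictness for \<open>x \<noteq> 0\<close> is what later forces a trivial
  intersection.\<close>

lemma rayleigh_eigensum_less:
  assumes "finite A" "\<And>\<mu>. \<mu> \<in> A \<Longrightarrow> \<mu> < l" "x \<in> eigensum A" "x \<noteq> 0"
  shows "P (T x) \<bullet> x < l * (P x \<bullet> x)"
  using assms
proof (induction A arbitrary: x)
  case empty
  then show ?case by (simp add: eigensum_empty)
next
  case (insert \<mu> A)
  then obtain y z where yz: "x = y + z" "y \<in> eigenspace \<mu>" "z \<in> eigensum A"
    by (auto simp: eigensum_insert)
  have Ty: "T y = \<mu> *\<^sub>R y" using yz by (simp add: eigenspace_def)
  have zy: "P z \<bullet> y = 0" using orthogonal_eigensum yz insert by blast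
  have Pyz: "P y \<bullet> z = 0" using zy P_comm by simp
  \<comment> \<open>Moving \<open>T\<close> onto the eigenvector \<open>y\<close> avoids showing
    that \<open>eigensum A\<close> is invariant.\<close>
  have TP: "P (T z) \<bullet> y = 0" using T_selfadjoint[of z y] Ty zy by simp
  have eq: "P (T x) \<bullet> x = \<mu> * (P y \<bullet> y) + P (T z) \<bullet> z" "P x \<bullet> x = P y \<bullet> y + P z \<bullet> z"
    using zy Pyz TP by (simp_all add: yz T_simps P_simps inner_add_left inner_add_right Ty)
  have z: "P (T z) \<bullet> z < l * (P z \<bullet> z)" if "z \<noteq> 0"
    using insert.IH[of z] insert.prems that yz by auto
  have y: "\<mu> * (P y \<bullet> y) < l * (P y \<bullet> y)" if "y \<noteq> 0"
    using P_pos[OF that] insert.prems by simp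
  show ?case
    using z y insert.prems(3) yz(1) unfolding eq
    by (cases "y = 0"; cases "z = 0") (auto simp: P_simps T_simps distrib_left)
qed

section \<open>Spectral theorem by maximizing the Rayleigh quotient\<close>

text \<open>The Rayleigh quotient attains its maximum on the compact unit sphere of
  \<open>S\<close>. A maximizer is an eigenvector, since otherwise the residual
  \<open>\<mu> *\<^sub>R x - T x\<close>, which lies in \<open>S\<close> by invariance, would be a
  direction of increase.\<close>

lemma exists_eigenvector_in_invariant_subspace:
  assumes "subspace S" "T ` S \<subseteq> S" "S \<noteq> {0}"
  obtains x \<mu> where "x \<in> S" "x \<noteq> 0" "T x = \<mu> *\<^sub>R x"
proof -
  define R where "R = (\<lambda>x. (P (T x) \<bullet> x) / (P x \<bullet> x))"
  let ?K = "S \<inter> sphere 0 1"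
  obtain s where s: "s \<in> S" "s \<noteq> 0" using assms subspace_0 by blast
  then have "sgn s \<in> ?K"
    using subspace_scale[OF assms(1)] by (simp add: sgn_div_norm norm_sgn)
  then have "?K \<noteq> {}" by blast
  moreover have "compact ?K"
    by (simp add: assms(1) closed_Int_compact closed_subspace)
  moreover have "continuous_on ?K R"
  proof -
    have "continuous_on ?K P" "continuous_on ?K T" "continuous_on (T ` ?K) P"
      using linear_T linear_P by (simp_all add: linear_conv_bounded_linear linear_continuous_on)
    moreover have "P x \<bullet> x \<noteq> 0" if "x \<in> ?K" for x
      using P_pos[of x] that by fastforce
    ultimately show ?thesis
      unfolding R_def
      by (intro continuous_on_divide continuous_on_inner continuous_on_id ballI
          continuous_on_compose2[of "T ` ?K" P ?K T]) auto
  qed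
  ultimately obtain x where x: "x \<in> ?K" "\<And>y. y \<in> ?K \<Longrightarrow> R y \<le> R x"
    using continuous_attains_sup[of ?K R] by metis
  then have xS: "x \<in> S" and x0: "x \<noteq> 0" by auto
  define \<mu> where "\<mu> = R x"
  \<comment> \<open>The form of \<open>\<mu> - T\<close>: maximality of \<open>\<mu>\<close> makes
    it nonnegative on \<open>S\<close>, with a zero at \<open>x\<close>.\<close>
  define q where "q = (\<lambda>y. \<mu> * (P y \<bullet> y) - P (T y) \<bullet> y)"
  have q_nonneg: "q y \<ge> 0" if "y \<in> S" for y
  proof (cases "y = 0")
    case True
    then show ?thesis by (simp add: q_def)
  next
    case False
    have "sgn y \<in> ?K"
      using False that subspace_scale[OF assms(1)] by (simp add: sgn_div_norm norm_sgn)
    moreover have "R (sgn y) = R y"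
      using False by (simp add: R_def sgn_div_norm T_simps P_simps field_simps)
    ultimately have "R y \<le> \<mu>" using x(2) \<mu>_def by metis
    then show ?thesis using P_pos[OF False]
      by (simp add: q_def R_def pos_divide_le_eq)
  qed
  have qx: "q x = 0" using P_pos[OF x0] by (simp add: q_def \<mu>_def R_def)
  define z where "z = \<mu> *\<^sub>R x - T x"
  have zS: "z \<in> S" unfolding z_def
    using xS assms by (intro subspace_diff subspace_scale) auto
  \<comment> \<open>The linear coefficient is twice the weighted product of
    \<open>\<mu> *\<^sub>R x - T x\<close>, which is \<open>z\<close> itself, with \<open>z\<close>;
    so it is positive unless \<open>z = 0\<close>.\<close>
  have expand: "q (x + t *\<^sub>R z) = 2 * t * (P z \<bullet> z) + t\<^sup>2 * q z" for t
  proof -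
    have "P (T z) \<bullet> x = P (T x) \<bullet> z"
      using T_selfadjoint[of z x] P_comm by simp
    then have "q (x + t *\<^sub>R z) = q x + 2 * t * (\<mu> * (P x \<bullet> z) - P (T x) \<bullet> z) + t\<^sup>2 * q z"
      using P_comm[of z x]
      by (simp add: q_def T_simps P_simps inner_add_left inner_add_right algebra_simps power2_eq_square)
    also have "\<mu> * (P x \<bullet> z) - P (T x) \<bullet> z = P z \<bullet> z"
      by (subst (3) z_def) (simp add: P_simps inner_diff_left)
    finally show ?thesis using qx by simp
  qed
  have "z = 0"
  proof (rule ccontr)
    assume "z \<noteq> 0"
    then have c: "P z \<bullet> z > 0" by (rule P_pos)
    have d: "q z \<ge> 0" using q_nonneg zS by blast
    \<comment> \<open>A negative \<open>t\<close> so small that the linear term outweighs the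
      quadratic one; the \<open>+ 1\<close> keeps the denominator positive when
      \<open>q z = 0\<close>.\<close>
    define t where "t = - (P z \<bullet> z) / (q z + 1)"
    have t: "t < 0" using c d by (simp add: t_def divide_neg_pos)
    have "t * (q z + 1) = - (P z \<bullet> z)" using d by (simp add: t_def)
    then have "2 * (P z \<bullet> z) + t * q z = (P z \<bullet> z) - t" by (simp add: algebra_simps)
    then have "2 * (P z \<bullet> z) + t * q z > 0" using c t by linarith
    then have "t * (2 * (P z \<bullet> z) + t * q z) < 0" using t by (simp add: mult_neg_pos)
    moreover have "q (x + t *\<^sub>R z) = t * (2 * (P z \<bullet> z) + t * q z)"
      by (simp add: expand power2_eq_square algebra_simps)
    moreover have "q (x + t *\<^sub>R z) \<ge> 0"
      using xS zS assms(1) by (intro q_nonneg) (simp add: subspace_add subspace_scale)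
    ultimately show False by simp
  qed
  then show thesis using that[of x \<mu>] xS x0 by (simp add: z_def)
qed

text \<open>If the eigenvectors did not span, the weighted orthogonal complement of their span would
  be nonzero and invariant. It would contain an eigenvector, which would then be orthogonal to
  itself.\<close>

theorem eigensum_eigenvalues: "eigensum eigenvalues = UNIV"
proof (rule ccontr)
  let ?E = "eigensum eigenvalues"
  assume "?E \<noteq> UNIV"
  then have "dim ?E < DIM('a)"
    using dim_eq_full[of ?E] dim_subset_UNIV[of ?E] span_eq_iff subspace_eigensum
    by (metis le_neq_implies_less)
  then obtain w where w: "w \<noteq> 0" "\<And>x. x \<in> ?E \<Longrightarrow> orthogonal w x"
    using orthogonal_to_subspace_exists[of ?E] span_base by metis
  \<comment> \<open>The vector \<open>w\<close> is orthogonal to \<open>?E\<close> for the ordinary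
    inner product. As \<open>P\<close> is onto, \<open>w = P v\<close>, and \<open>v\<close> is
    orthogonal to \<open>?E\<close> for the weighted one.\<close>
  have "inj P"
    using P_pos linear_injective_0[OF linear_P] by (metis inner_zero_left less_irrefl)
  then obtain v where v: "w = P v"
    using linear_injective_imp_surjective[OF linear_P] by (metis surjD)
  define S where "S = {y. \<forall>x\<in>?E. P y \<bullet> x = 0}"
  have subS: "subspace S"
    unfolding S_def by (rule subspaceI) (auto simp: P_simps inner_add_left)
  have TE: "T x \<in> ?E" if "x \<in> ?E" for x
  proof -
    have "subspace {x. T x \<in> ?E}"
      unfolding eigensum_def
      by (rule subspaceI) (auto simp: T_simps span_0 span_add span_scale)
    moreover have "(\<Union>\<mu>\<in>eigenvalues. eigenspace \<mu>) \<subseteq> {x. T x \<in> ?E}"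
    proof clarify
      fix \<mu> x assume x: "\<mu> \<in> eigenvalues" "x \<in> eigenspace \<mu>"
      then have "x \<in> ?E" unfolding eigensum_def by (auto intro: span_base)
      then show "T x \<in> ?E"
        using x(2) subspace_scale[OF subspace_eigensum] by (simp add: eigenspace_def)
    qed
    ultimately have "?E \<subseteq> {x. T x \<in> ?E}"
      by (metis eigensum_def span_minimal)
    then show ?thesis using that by blast
  qed
  have "T ` S \<subseteq> S" using TE by (auto simp: S_def T_selfadjoint)
  moreover have "v \<in> S" "v \<noteq> 0" using w v by (auto simp: S_def orthogonal_def P_simps)
  ultimately obtain x \<mu> where x: "x \<in> S" "x \<noteq> 0" "T x = \<mu> *\<^sub>R x"
    using exists_eigenvector_in_invariant_subspace[OF subS] by blast
  then have "x \<in> ?E"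
    unfolding eigensum_def by (intro span_base) (auto simp: eigenvalues_def eigenspace_def)
  then have "P x \<bullet> x = 0" using x by (auto simp: S_def)
  then show False using P_pos[OF x(2)] by simp
qed

section \<open>Dimension counts\<close>

lemma finite_eigenvalues: "finite eigenvalues"
proof (rule ccontr)
  assume "infinite eigenvalues"
  then obtain A where A: "finite A" "card A = Suc DIM('a)" "A \<subseteq> eigenvalues"
    using infinite_arbitrarily_large by blast
  have "dim (eigenspace \<mu>) \<ge> 1" if "\<mu> \<in> A" for \<mu>
  proof -
    have "\<not> eigenspace \<mu> \<subseteq> {0}"
      using that A by (auto simp: eigenvalues_def eigenspace_def)
    then show ?thesis using dim_eq_0 by (metis less_one not_le)
  qed
  then have "card A \<le> (\<Sum>\<mu>\<in>A. dim (eigenspace \<mu>))"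
    using sum_mono[of A "\<lambda>_. 1" "\<lambda>\<mu>. dim (eigenspace \<mu>)"] by simp
  also have "\<dots> = dim (eigensum A)" using dim_eigensum A by simp
  also have "\<dots> \<le> DIM('a)" by (rule dim_subset_UNIV)
  finally show False using A by simp
qed

lemma sum_dim_eigenspace: "(\<Sum>\<mu>\<in>eigenvalues. dim (eigenspace \<mu>)) = DIM('a)"
  using dim_eigensum[OF finite_eigenvalues] by (simp add: eigensum_eigenvalues)

text \<open>On nonzero vectors of the sum of the eigenspaces below \<open>l\<close> the Rayleigh
  quotient is less than \<open>l\<close>, so this sum meets \<open>S\<close> only in 0 and the two
  dimensions fit into the whole space.\<close>

lemma dim_rayleigh_ge:
  assumes "subspace S" "\<And>x. x \<in> S \<Longrightarrow> P (T x) \<bullet> x \<ge> l * (P x \<bullet> x)"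
  shows "dim S + (\<Sum>\<mu> | \<mu> \<in> eigenvalues \<and> \<mu> < l. dim (eigenspace \<mu>)) \<le> DIM('a)"
proof -
  let ?A = "{\<mu> \<in> eigenvalues. \<mu> < l}"
  have fin: "finite ?A" using finite_eigenvalues by simp
  have "x = 0" if "x \<in> S" "x \<in> eigensum ?A" for x
    using rayleigh_eigensum_less[OF fin _ that(2), of l] assms(2)[OF that(1)] by fastforce
  then have "dim (S \<inter> eigensum ?A) = 0" by (auto simp: dim_eq_0)
  then have "dim S + dim (eigensum ?A) = dim {x + y | x y. x \<in> S \<and> y \<in> eigensum ?A}"
    using dim_sums_Int[OF assms(1) subspace_eigensum, of ?A] by linarith
  also have "\<dots> \<le> DIM('a)" by (rule dim_subset_UNIV)
  finally show ?thesis using dim_eigensum[OF fin] by simp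
qed

end

section \<open>Counting eigenvalues\<close>

lemma filter_mset_sum_replicate:
  assumes "finite A"
  shows "filter_mset Q (\<Sum>\<mu>\<in>A. replicate_mset (m \<mu>) \<mu>)
    = (\<Sum>\<mu> | \<mu> \<in> A \<and> Q \<mu>. replicate_mset (m \<mu>) \<mu>)"
  using assms
proof (induction A)
  case (insert a A)
  have "{\<mu>. (\<mu> = a \<or> \<mu> \<in> A) \<and> Q \<mu>} = (if Q a then insert a {\<mu>. \<mu> \<in> A \<and> Q \<mu>} else {\<mu>. \<mu> \<in> A \<and> Q \<mu>})"
    by auto
  moreover have "filter_mset Q (replicate_mset (m a) a) = (if Q a then replicate_mset (m a) a else {#})"
    by (induction "m a") (auto simp: filter_mset_eq_conv)
  ultimately show ?case using insert by simp
qed simp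

lemma size_sum_replicate_mset: "size (\<Sum>\<mu>\<in>A. replicate_mset (m \<mu>) \<mu>) = (\<Sum>\<mu>\<in>A. m \<mu>)"
  by simp

lemma sorted_nth_filter_le:
  fixes xs :: "'a::linorder list"
  assumes "sorted xs" "1 \<le> k" "k \<le> length xs"
  shows "k \<le> length (filter (\<lambda>x. x \<le> xs ! (k - 1)) xs)"
proof -
  have "\<forall>x\<in>set (take k xs). x \<le> xs ! (k - 1)"
    using assms by (auto simp: set_conv_nth sorted_nth_mono)
  then have "filter (\<lambda>x. x \<le> xs ! (k - 1)) (take k xs) = take k xs"
    by simp
  then have "k = length (filter (\<lambda>x. x \<le> xs ! (k - 1)) (take k xs))"
    using assms by simp
  also have "\<dots> \<le> length (filter (\<lambda>x. x \<le> xs ! (k - 1)) (take k xs @ drop k xs))"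
    by (simp only: filter_append length_append)
  finally show ?thesis by simp
qed

text \<open>At least \<open>k\<close> entries of the sorted list are at most its \<open>k\<close>-th
  entry \<open>l\<close>. With \<open>m l = r\<close> this leaves at least \<open>k - r\<close>
  entries strictly below \<open>l\<close>.\<close>

lemma kth_le_sum_mult:
  fixes m :: "'a::linorder \<Rightarrow> nat"
  assumes "finite A" "1 \<le> k" "k \<le> (\<Sum>\<mu>\<in>A. m \<mu>)"
    and l: "l = sorted_list_of_multiset (\<Sum>\<mu>\<in>A. replicate_mset (m \<mu>) \<mu>) ! (k - 1)"
  shows "k \<le> (\<Sum>\<mu> | \<mu> \<in> A \<and> \<mu> < l. m \<mu>) + m l"
proof -
  let ?M = "\<Sum>\<mu>\<in>A. replicate_mset (m \<mu>) \<mu>"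
  let ?xs = "sorted_list_of_multiset ?M"
  have "length ?xs = size (mset ?xs)" by (simp only: size_mset)
  then have len: "length ?xs = (\<Sum>\<mu>\<in>A. m \<mu>)"
    by (simp add: size_sum_replicate_mset)
  have "k \<le> length (filter (\<lambda>x. x \<le> l) ?xs)"
    unfolding l using assms len by (intro sorted_nth_filter_le) auto
  also have "\<dots> = size (filter_mset (\<lambda>x. x \<le> l) ?M)"
    by (metis mset_filter mset_sorted_list_of_multiset size_mset)
  also have "\<dots> = (\<Sum>\<mu> | \<mu> \<in> A \<and> \<mu> \<le> l. m \<mu>)"
    by (simp add: filter_mset_sum_replicate[OF assms(1)] size_sum_replicate_mset)
  \<comment> \<open>Inserting \<open>l\<close> isolates its multiplicity; an inclusion of index sets
    is enough, without deciding whether \<open>l\<close> lies in \<open>A\<close>.\<close>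
  also have "\<dots> \<le> (\<Sum>\<mu>\<in>insert l {\<mu>. \<mu> \<in> A \<and> \<mu> < l}. m \<mu>)"
    using assms(1) by (intro sum_mono2) auto
  also have "\<dots> = (\<Sum>\<mu> | \<mu> \<in> A \<and> \<mu> < l. m \<mu>) + m l"
    using assms(1) by simp
  finally show ?thesis .
qed

section \<open>Connected components\<close>

lemma joined_sym: "joined E i j \<Longrightarrow> joined E j i"
  unfolding joined_def
  by (rule sympD[OF symp_rtranclp]) (auto simp: symp_def)

lemma joined_trans: "joined E i j \<Longrightarrow> joined E j k \<Longrightarrow> joined E i k"
  unfolding joined_def by simp

lemma joined_refl: "joined E i i"
  unfolding joined_def by simp

text \<open>Adding \<open>j\<close> to \<open>C\<close> keeps all pairs joined, so maximality of
  \<open>C\<close> applies to \<open>insert j C\<close>.\<close>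

lemma connected_components_closed:
  assumes C: "C \<in> connected_components W E" and "i \<in> C" "j \<in> W" "joined E i j"
  shows "j \<in> C"
proof -
  have C': "\<forall>a\<in>C. \<forall>b\<in>C. joined E a b" "C \<subseteq> W"
    and max: "\<And>D. C \<subseteq> D \<Longrightarrow> D \<subseteq> W \<Longrightarrow> \<forall>a\<in>D. \<forall>b\<in>D. joined E a b \<Longrightarrow> D = C"
    using C unfolding connected_components_def by simp_all
  have j: "joined E a j" if "a \<in> C" for a
    using C'(1) that assms(2,4) joined_trans by metis
  have "\<forall>a\<in>insert j C. \<forall>b\<in>insert j C. joined E a b"
    using C'(1) j joined_sym[OF j] joined_refl[of E j] by blast
  then have "insert j C = C"
    using C'(2) assms(3) by (intro max) auto
  then show ?thesis by blast
qed

lemma connected_components_disjoint: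
  assumes "C \<in> connected_components W E" "D \<in> connected_components W E" "C \<noteq> D"
  shows "C \<inter> D = {}"
proof (rule ccontr)
  assume "C \<inter> D \<noteq> {}"
  then obtain i where i: "i \<in> C" "i \<in> D" by blast
  have "C' \<subseteq> D'" if "C' \<in> connected_components W E" "D' \<in> connected_components W E"
    "i \<in> C'" "i \<in> D'" for C' D'
  proof
    fix j assume "j \<in> C'"
    with that(1,3) have "j \<in> W" "joined E i j"
      unfolding connected_components_def by auto
    then show "j \<in> D'" by (rule connected_components_closed[OF that(2,4)])
  qed
  then show False using assms i by (meson subset_antisym)
qed

section \<open>The Laplacian with only inputs\<close>

context
  fixes H :: "'v::finite hyperedge set"
  assumes deg: "\<And>i. hdegree H i \<noteq> 0" and inputs: "\<And>h. h \<in> H \<Longrightarrow> snd h = {}"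
begin

text \<open>The entries of the matrix \<open>B\<close>; those on the diagonal are the
  degrees.\<close>

definition codegree :: "'v \<Rightarrow> 'v \<Rightarrow> real" where
  "codegree i j = real (card {h \<in> H. i \<in> verts h \<and> j \<in> verts h})"

text \<open>The matrix \<open>D\<close>, which serves as the weight \<open>P\<close>.\<close>

definition degree_op :: "real ^ 'v \<Rightarrow> real ^ 'v" where
  "degree_op f = (\<chi> i. real (hdegree H i) * f $ i)"

lemma codegree_commute: "codegree i j = codegree j i"
  unfolding codegree_def by (simp add: conj_commute)

text \<open>Exchanging the sums over hyperedges and vertices counts \<open>f $ j\<close> once for
  each hyperedge containing both \<open>i\<close> and \<open>j\<close>. The output half of the
  Laplacian is an empty sum.\<close>

lemma laplacian_nth:
  "laplacian H f $ i = (\<Sum>j\<in>UNIV. codegree i j * f $ j) / real (hdegree H i)"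
proof -
  have v: "verts h = fst h" if "h \<in> H" for h using inputs[OF that] by (simp add: verts_def)
  have "(\<Sum>h | h \<in> H \<and> i \<in> fst h. (\<Sum>i'\<in>fst h. f $ i') - (\<Sum>j'\<in>snd h. f $ j'))
      = (\<Sum>h | h \<in> H \<and> i \<in> fst h. \<Sum>j\<in>UNIV. if j \<in> fst h then f $ j else 0)"
    by (rule sum.cong) (auto simp: inputs sum.If_cases)
  also have "\<dots> = (\<Sum>j\<in>UNIV. \<Sum>h | h \<in> H \<and> i \<in> fst h. if j \<in> fst h then f $ j else 0)"
    by (rule sum.swap)
  also have "\<dots> = (\<Sum>j\<in>UNIV. codegree i j * f $ j)"
  proof (rule sum.cong)
    fix j
    have "{h \<in> H. i \<in> verts h \<and> j \<in> verts h} = {h. h \<in> H \<and> i \<in> fst h} \<inter> {h. j \<in> fst h}"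
      using v by auto
    then show "(\<Sum>h | h \<in> H \<and> i \<in> fst h. if j \<in> fst h then f $ j else 0) = codegree i j * f $ j"
      by (simp add: sum.If_cases codegree_def)
  qed simp
  finally have *: "(\<Sum>h | h \<in> H \<and> i \<in> fst h. (\<Sum>i'\<in>fst h. f $ i') - (\<Sum>j'\<in>snd h. f $ j'))
    = (\<Sum>j\<in>UNIV. codegree i j * f $ j)" .
  have "{h. h \<in> H \<and> i \<in> snd h} = {}" using inputs by auto
  then show ?thesis unfolding laplacian_def vec_lambda_beta * by (simp only: sum.empty) simp
qed

lemma degree_op_laplacian_nth:
  "degree_op (laplacian H f) $ i = (\<Sum>j\<in>UNIV. codegree i j * f $ j)"
  using deg[of i] by (simp add: degree_op_def laplacian_nth)

lemma degree_op_laplacian_inner: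
  "degree_op (laplacian H f) \<bullet> g = (\<Sum>i\<in>UNIV. \<Sum>j\<in>UNIV. codegree i j * f $ j * g $ i)"
  by (simp add: inner_vec_def degree_op_laplacian_nth sum_distrib_right)

text \<open>\<open>D\<close> is positive definite because no degree vanishes, and self-adjointness
  of the Laplacian is the symmetry of \<open>B\<close>.\<close>

lemma laplacian_weighted_selfadjoint: "weighted_selfadjoint (laplacian H) degree_op"
proof
  show "laplacian H (f + g) = laplacian H f + laplacian H g" for f g
    by (simp add: vec_eq_iff laplacian_nth distrib_left sum.distrib add_divide_distrib)
  show "laplacian H (c *\<^sub>R f) = c *\<^sub>R laplacian H f" for c f
    by (simp add: vec_eq_iff laplacian_nth sum_distrib_left mult.left_commute)
  show "degree_op (f + g) = degree_op f + degree_op g" for f g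
    by (simp add: vec_eq_iff degree_op_def distrib_left)
  show "degree_op (c *\<^sub>R f) = c *\<^sub>R degree_op f" for c f
    by (simp add: vec_eq_iff degree_op_def)
  show sym: "degree_op f \<bullet> g = f \<bullet> degree_op g" for f g
    by (simp add: inner_vec_def degree_op_def mult_ac)
  show "degree_op f \<bullet> f > 0" if nz: "f \<noteq> 0" for f
  proof -
    obtain i where "f $ i \<noteq> 0" using nz by (metis vec_eq_iff zero_index)
    then have "0 < real (hdegree H i) * f $ i * f $ i"
      using deg[of i] by (simp add: mult.assoc flip: power2_eq_square)
    then show ?thesis unfolding inner_vec_def degree_op_def
      by (intro sum_pos2[of _ i]) (auto simp: mult.assoc simp flip: power2_eq_square)
  qed
  show "degree_op (laplacian H f) \<bullet> g = degree_op f \<bullet> laplacian H g" for f g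
  proof -
    have "degree_op f \<bullet> laplacian H g = degree_op (laplacian H g) \<bullet> f"
      by (metis sym inner_commute)
    also have "\<dots> = (\<Sum>j\<in>UNIV. \<Sum>i\<in>UNIV. codegree j i * g $ i * f $ j)"
      by (rule degree_op_laplacian_inner)
    also have "\<dots> = (\<Sum>i\<in>UNIV. \<Sum>j\<in>UNIV. codegree j i * g $ i * f $ j)"
      by (rule sum.swap)
    also have "\<dots> = degree_op (laplacian H f) \<bullet> g"
      by (simp add: degree_op_laplacian_inner codegree_commute mult_ac)
    finally show ?thesis by simp
  qed
qed

lemma rayleigh_ge_of_multiplier:
  assumes f: "laplacian H f = l *\<^sub>R f"
    and g: "\<And>i. g $ i = a i * f $ i"
    and a: "\<And>i j h. h \<in> H \<Longrightarrow> i \<in> verts h \<Longrightarrow> j \<in> verts h \<Longrightarrow> f $ i * f $ j > 0 \<Longrightarrow> a i = a j"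
  shows "degree_op (laplacian H g) \<bullet> g \<ge> l * (degree_op g \<bullet> g)"
proof -
  define w where "w = (\<lambda>i j. codegree i j * f $ i * f $ j)"
  have wsym: "w i j = w j i" for i j by (simp add: w_def codegree_commute mult_ac)
  have 1: "degree_op (laplacian H g) \<bullet> g = (\<Sum>i\<in>UNIV. \<Sum>j\<in>UNIV. w i j * (a i * a j))"
    by (simp add: degree_op_laplacian_inner g w_def mult_ac)
  \<comment> \<open>The eigenvalue equation at \<open>i\<close>, multiplied by
    \<open>(a i)\<^sup>2 * f $ i\<close> and summed, brings in the same weights \<open>w\<close> as
    in the other form.\<close>
  have "l * (degree_op g \<bullet> g) = (\<Sum>i\<in>UNIV. (a i)\<^sup>2 * f $ i * (degree_op (laplacian H f) $ i))"
    unfolding f by (simp add: inner_vec_def degree_op_def g sum_distrib_left power2_eq_square mult_ac)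
  also have "\<dots> = (\<Sum>i\<in>UNIV. \<Sum>j\<in>UNIV. w i j * (a i)\<^sup>2)"
    by (simp add: degree_op_laplacian_nth sum_distrib_left w_def mult_ac)
  finally have 2: "l * (degree_op g \<bullet> g) = (\<Sum>i\<in>UNIV. \<Sum>j\<in>UNIV. w i j * (a i)\<^sup>2)" .
  have 3: "(\<Sum>i\<in>UNIV. \<Sum>j\<in>UNIV. w i j * (a i)\<^sup>2) = (\<Sum>i\<in>UNIV. \<Sum>j\<in>UNIV. w i j * (a j)\<^sup>2)"
    by (subst sum.swap) (simp add: wsym)
  \<comment> \<open>A positive \<open>w i j\<close> requires a common hyperedge and equal signs, and
    then \<open>a i = a j\<close>; in all other cases \<open>w i j \<le> 0\<close>.\<close>
  have "w i j * (a i - a j)\<^sup>2 \<le> 0" for i j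
  proof (cases "f $ i * f $ j > 0 \<and> codegree i j \<noteq> 0")
    case True
    then obtain h where "h \<in> H" "i \<in> verts h" "j \<in> verts h"
      by (fastforce simp: codegree_def)
    then have "a i = a j" using a True by blast
    then show ?thesis by simp
  next
    case False
    then have "codegree i j = 0 \<or> f $ i * f $ j \<le> 0" by auto
    moreover have "codegree i j \<ge> 0" by (simp add: codegree_def)
    ultimately have "w i j \<le> 0" by (auto simp: w_def mult.assoc mult_nonneg_nonpos)
    then show ?thesis by (simp add: mult_nonpos_nonneg)
  qed
  then have "(\<Sum>i\<in>UNIV. \<Sum>j\<in>UNIV. w i j * (a i - a j)\<^sup>2) \<le> 0"
    by (intro sum_nonpos) auto
  \<comment> \<open>By symmetry the two sums of squares agree, so the right side is twice the
    difference between \<open>l * (degree_op g \<bullet> g)\<close> and the form of the Laplacian at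
    \<open>g\<close>.\<close>
  moreover have "(\<Sum>i\<in>UNIV. \<Sum>j\<in>UNIV. w i j * (a i - a j)\<^sup>2)
    = (\<Sum>i\<in>UNIV. \<Sum>j\<in>UNIV. w i j * (a i)\<^sup>2) + (\<Sum>i\<in>UNIV. \<Sum>j\<in>UNIV. w i j * (a j)\<^sup>2)
      - 2 * (\<Sum>i\<in>UNIV. \<Sum>j\<in>UNIV. w i j * (a i * a j))"
    by (simp add: power2_eq_square algebra_simps sum.distrib sum_subtractf sum_distrib_left)
  ultimately show ?thesis using 1 2 3 by linarith
qed

end

section \<open>Nodal domains\<close>

definition restrict_vec :: "'v set \<Rightarrow> real ^ 'v \<Rightarrow> real ^ 'v" where
  "restrict_vec C f = (\<chi> i. if i \<in> C then f $ i else 0)"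

abbreviation nodal_domains :: "'v::finite hyperedge set \<Rightarrow> real ^ 'v \<Rightarrow> 'v set set" where
  "nodal_domains H f \<equiv> pos_nodal_domains H f \<union> neg_nodal_domains H f"

lemma pos_nodal_domain_subset: "C \<in> pos_nodal_domains H f \<Longrightarrow> C \<noteq> {} \<and> C \<subseteq> supp_pos f"
  by (auto simp: pos_nodal_domains_def connected_components_def)

lemma neg_nodal_domain_subset: "C \<in> neg_nodal_domains H f \<Longrightarrow> C \<noteq> {} \<and> C \<subseteq> supp_neg f"
  by (auto simp: neg_nodal_domains_def connected_components_def)

lemma supp_disjoint: "supp_pos f \<inter> supp_neg f = {}"
  by (auto simp: supp_pos_def supp_neg_def)

lemma nodal_domain_nonzero:
  assumes "C \<in> nodal_domains H f"
  shows "C \<noteq> {}" "\<And>i. i \<in> C \<Longrightarrow> f $ i \<noteq> 0"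
  using assms pos_nodal_domain_subset neg_nodal_domain_subset
  by (fastforce simp: supp_pos_def supp_neg_def)+

lemma nodal_domains_disjoint:
  assumes "C \<in> nodal_domains H f" "D \<in> nodal_domains H f" "C \<noteq> D"
  shows "C \<inter> D = {}"
proof -
  have 1: "C \<inter> D = {}" if "C \<in> pos_nodal_domains H f" "D \<in> neg_nodal_domains H f" for C D
    using that pos_nodal_domain_subset neg_nodal_domain_subset supp_disjoint by fast
  have 2: "C \<inter> D = {}" if "C \<in> pos_nodal_domains H f" "D \<in> pos_nodal_domains H f" "C \<noteq> D" for C D
    by (rule connected_components_disjoint[OF that[unfolded pos_nodal_domains_def]])
  have 3: "C \<inter> D = {}" if "C \<in> neg_nodal_domains H f" "D \<in> neg_nodal_domains H f" "C \<noteq> D" for C D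
    by (rule connected_components_disjoint[OF that[unfolded neg_nodal_domains_def]])
  show ?thesis
    using assms 1[of C D] 1[of D C] 2[of C D] 3[of C D] by (auto simp: Int_commute)
qed

text \<open>Vertices of equal sign in \<open>h\<close> stay together in the restriction of
  \<open>h\<close> to the support of that sign, so one step joins them.\<close>

lemma nodal_domain_closed:
  assumes C: "C \<in> nodal_domains H f" and i: "i \<in> C"
    and h: "h \<in> H" "i \<in> verts h" "j \<in> verts h" and ij: "f $ i * f $ j > 0"
  shows "j \<in> C"
proof -
  have J: "joined {verts h \<inter> W | h. h \<in> H} i j" if "i \<in> W" "j \<in> W" for W
    unfolding joined_def using that h by (intro r_into_rtranclp) blast
  from C show ?thesis
  proof
    assume C: "C \<in> pos_nodal_domains H f"
    then have "i \<in> supp_pos f" using i pos_nodal_domain_subset by blast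
    moreover from this have "j \<in> supp_pos f"
      using ij by (simp add: supp_pos_def zero_less_mult_iff)
    ultimately show ?thesis
      by (intro connected_components_closed[OF C[unfolded pos_nodal_domains_def] i] J)
  next
    assume C: "C \<in> neg_nodal_domains H f"
    then have "i \<in> supp_neg f" using i neg_nodal_domain_subset by blast
    moreover from this have "j \<in> supp_neg f"
      using ij by (simp add: supp_neg_def zero_less_mult_iff)
    ultimately show ?thesis
      by (intro connected_components_closed[OF C[unfolded neg_nodal_domains_def] i] J)
  qed
qed

section \<open>The span of the restrictions to nodal domains\<close>

text \<open>The restrictions are nonzero with disjoint supports, hence orthogonal and independent.
  Domains of opposite sign are nonempty and disjoint, so none is counted twice.\<close>

lemma dim_span_nodal_restrictions:
  "dim (span ((\<lambda>C. restrict_vec C f) ` nodal_domains H f))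
    = card (pos_nodal_domains H f) + card (neg_nodal_domains H f)"
proof -
  let ?N = "nodal_domains H f" and ?R = "\<lambda>C. restrict_vec C f"
  have nth: "?R C $ i \<noteq> 0 \<longleftrightarrow> i \<in> C" if "C \<in> ?N" for C i
    using nodal_domain_nonzero[OF that] by (auto simp: restrict_vec_def)
  have inj: "inj_on ?R ?N"
    proof (rule inj_onI)
    fix C D assume "C \<in> ?N" "D \<in> ?N" "?R C = ?R D"
    then show "C = D" using nth[of C] nth[of D] by auto
  qed
  have nz: "0 \<notin> ?R ` ?N"
  proof
    assume "0 \<in> ?R ` ?N"
    then obtain C where C: "C \<in> ?N" "?R C = 0" by force
    then show False using nth[OF C(1)] nodal_domain_nonzero(1)[OF C(1)] by auto
  qed
  have "orthogonal (?R C) (?R D)" if "C \<in> ?N" "D \<in> ?N" "C \<noteq> D" for C D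
    using nodal_domains_disjoint[OF that]
    unfolding orthogonal_def inner_vec_def restrict_vec_def by (intro sum.neutral) auto
  then have "pairwise orthogonal (?R ` ?N)"
    unfolding pairwise_def by blast
  then have "independent (?R ` ?N)" using nz by (rule pairwise_orthogonal_independent)
  then have "dim (span (?R ` ?N)) = card ?N"
    by (simp add: dim_eq_card_independent card_image[OF inj])
  also have "\<dots> = card (pos_nodal_domains H f) + card (neg_nodal_domains H f)"
  proof (rule card_Un_disjoint)
    show "pos_nodal_domains H f \<inter> neg_nodal_domains H f = {}"
      using pos_nodal_domain_subset neg_nodal_domain_subset supp_disjoint by fast
  qed simp_all
  finally show ?thesis .
qed

text \<open>Having such a multiplier is preserved by linear combinations, so it suffices to give one
  for each restriction: the indicator of the domain.\<close>

lemma span_nodal_restrictions_multiplier: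
  assumes "g \<in> span ((\<lambda>C. restrict_vec C f) ` nodal_domains H f)"
  obtains a where "\<And>i. g $ i = a i * f $ i"
    "\<And>i j h. h \<in> H \<Longrightarrow> i \<in> verts h \<Longrightarrow> j \<in> verts h \<Longrightarrow> f $ i * f $ j > 0 \<Longrightarrow> a i = a j"
proof -
  define Q where "Q = (\<lambda>g a. (\<forall>i. g $ i = a i * f $ i) \<and>
    (\<forall>h\<in>H. \<forall>i\<in>verts h. \<forall>j\<in>verts h. f $ i * f $ j > 0 \<longrightarrow> a i = (a j :: real)))"
  have "subspace {g. \<exists>a. Q g a}"
  proof (rule subspaceI; clarify?)
    show "\<exists>a. Q 0 a" by (rule exI[of _ "\<lambda>_. 0"]) (simp add: Q_def)
    show "\<exists>a. Q (x + y) a" if "Q x a" "Q y b" for x y a b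
      using that by (intro exI[of _ "\<lambda>i. a i + b i"]) (auto simp: Q_def distrib_right)
    show "\<exists>a. Q (c *\<^sub>R x) a" if "Q x a" for c x a
      using that by (intro exI[of _ "\<lambda>i. c * a i"]) (auto simp: Q_def)
  qed
  moreover have "Q (restrict_vec C f) (indicator C)" if "C \<in> nodal_domains H f" for C
  proof -
    \<comment> \<open>Closedness of \<open>C\<close> is used from \<open>i\<close> to
      \<open>j\<close> and from \<open>j\<close> to \<open>i\<close>.\<close>
    have "indicator C i = (indicator C j :: real)"
      if "h \<in> H" "i \<in> verts h" "j \<in> verts h" "f $ i * f $ j > 0" for h i j
      using nodal_domain_closed[OF \<open>C \<in> _\<close>, of i h j] nodal_domain_closed[OF \<open>C \<in> _\<close>, of j h i] that
      by (auto simp: indicator_def mult.commute)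
    then show ?thesis by (auto simp: Q_def restrict_vec_def)
  qed
  ultimately have "span ((\<lambda>C. restrict_vec C f) ` nodal_domains H f) \<subseteq> {g. \<exists>a. Q g a}"
    by (intro span_minimal) auto
  then obtain a where "Q g a" using assms by blast
  then show thesis using that[of a] unfolding Q_def by blast
qed

section \<open>The bound on the number of nodal domains\<close>

theorem theorem2:
  fixes H :: "'v::finite hyperedge set" and f :: "real ^ 'v" and k n r :: nat
  assumes "oriented_hypergraph H"
    and "n = CARD('v)"
    and "\<And>i. hdegree H i \<noteq> 0"
    and "\<And>h. h \<in> H \<Longrightarrow> snd h = {}"
    and "1 \<le> k" and "k \<le> n"
    and "eigenfunction (laplacian H) (kth_eigenvalue (laplacian H) k) f"
    and "r = eigenvalue_mult (laplacian H) (kth_eigenvalue (laplacian H) k)"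
  shows "card (pos_nodal_domains H f) + card (neg_nodal_domains H f) \<le> n - k + r"
proof -
  let ?L = "laplacian H"
  interpret weighted_selfadjoint ?L "degree_op H"
    by (rule laplacian_weighted_selfadjoint) (use assms in auto)
  define l where "l = kth_eigenvalue ?L k"
  have dims: "eigenvalue_mult ?L \<mu> = dim (eigenspace \<mu>)" for \<mu>
    by (simp add: eigenvalue_mult_def eigenspace_def)
  have evs: "{\<mu>. \<exists>f. eigenfunction ?L \<mu> f} = eigenvalues"
    by (simp add: eigenfunction_def eigenvalues_def)
  have n: "DIM(real ^ 'v) = n" using assms(2) by simp
  \<comment> \<open>Thus the eigenspaces below \<open>l\<close> have total dimension at least
    \<open>k - r\<close>.\<close>
  have k: "k \<le> (\<Sum>\<mu> | \<mu> \<in> eigenvalues \<and> \<mu> < l. dim (eigenspace \<mu>)) + r"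
    unfolding assms(8) dims l_def[symmetric]
    by (rule kth_le_sum_mult)
      (use assms in \<open>simp_all add: finite_eigenvalues sum_dim_eigenspace l_def
        kth_eigenvalue_def eigenvalue_list_def dims evs\<close>)
  let ?S = "span ((\<lambda>C. restrict_vec C f) ` nodal_domains H f)"
  have Lf: "?L f = l *\<^sub>R f" using assms(7) by (simp add: eigenfunction_def l_def)
  have "degree_op H (?L g) \<bullet> g \<ge> l * (degree_op H g \<bullet> g)" if g: "g \<in> ?S" for g
  proof -
    obtain a where a: "\<And>i. g $ i = a i * f $ i"
      "\<And>i j h. h \<in> H \<Longrightarrow> i \<in> verts h \<Longrightarrow> j \<in> verts h \<Longrightarrow> f $ i * f $ j > 0 \<Longrightarrow> a i = a j"
      using span_nodal_restrictions_multiplier[OF g] by blast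
    show ?thesis
      using rayleigh_ge_of_multiplier[of H f l g a] assms(3,4) Lf a by blast
  qed
  then have "dim ?S + (\<Sum>\<mu> | \<mu> \<in> eigenvalues \<and> \<mu> < l. dim (eigenspace \<mu>)) \<le> n"
    using dim_rayleigh_ge[of ?S l] n by simp
  \<comment> \<open>The two dimension bounds combine; \<open>k \<le> n\<close> makes the subtraction
    of natural numbers exact.\<close>
  then show ?thesis
    using k assms(6) unfolding dim_span_nodal_restrictions by linarith
qed

end
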